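(* If $\varphi:\mathcal A\to M_n(\mathbb C)$ is a linear isometry, then for all $k=1,2,\dots,n-1$, $$\ker\varphi(S)\subseteq\ker\varphi(S^k)\quad\text{and}\quad \operatorname{ran}\varphi(S)\supseteq\operatorname{ran}\varphi(S^k).$$
   Context: $S$ denotes the $n\times n$ nilpotent Jordan block with ones on the superdiagonal and zeros elsewhere. $\mathcal A=\{f(S): f\text{ a complex polynomial}\}$ is the algebra of $n\times n$ upper-triangular Toeplitz matrices. $M_n(\mathbb C)$ carries the operator norm induced by the Euclidean norm on $\mathbb C^n$; a linear isometry is a linear map with $\|\varphi(A)\|=\|A\|$ for all $A$. $\ker$ and $\operatorname{ran}$ denote kernel and range of a matrix acting on $\mathbb C^n$. *)

theory Defs
  imports "HOL-Analysis.Analysis" "HOL-Computational_Algebra.Polynomial"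
begin

text \<open>Matrices are complex^'n^'n, with the index type 'n finite and well-ordered;
the position of an index i in {0..<CARD('n)} is the number of indices below it.\<close>

definition idx_pos :: "'n::{finite,wellorder} \<Rightarrow> nat" where
  "idx_pos i = card {j. j < i}"

definition shift_mat :: "complex ^('n::{finite,wellorder}) ^('n::{finite,wellorder})" where
  "shift_mat = (\<chi> i j. if idx_pos j = Suc (idx_pos i) then 1 else 0)"

text \<open>Matrix power w.r.t. the matrix product (the ring power on vec is entrywise).\<close>
primrec mat_pow :: "complex ^('n::finite) ^('n::finite) \<Rightarrow> nat \<Rightarrow> complex ^('n::finite) ^('n::finite)" where
  "mat_pow M 0 = mat 1"
| "mat_pow M (Suc k) = M ** mat_pow M k"

definition poly_mat :: "complex poly \<Rightarrow> complex ^('n::finite) ^('n::finite) \<Rightarrow> complex ^('n::finite) ^('n::finite)" where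
  "poly_mat f M = (\<Sum>i\<le>degree f. mat (coeff f i) ** mat_pow M i)"

definition toeplitz_alg :: "(complex ^('n::{finite,wellorder}) ^('n::{finite,wellorder})) set" where
  "toeplitz_alg = {poly_mat f shift_mat | f. True}"

definition op_norm :: "complex ^('n::finite) ^('m::finite) \<Rightarrow> real" where
  "op_norm A = onorm (\<lambda>x. A *v x)"

end

(* Write B_k = phi(S^k). For |z| = 1 let G_z = I + 2 (conj(z) S + conj(z)^2 S^2 + ...); its real part
   is the rank one matrix v v^* with v = (1, z, z^2, ...), and for the n-th roots z_j of a unimodular
   number w the G_{z_j} add up to n I. The derivative of the norm at I in the direction of G, which
   phi transports to B_0, is the largest eigenvalue of the real part of G. Applied to the G_{z_j} this
   yields an orthonormal basis x_j on which B_0 is isometric and with Re(B_0^* phi(G_{z_j})) equal to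
   n x_j x_j^*. Hence B_0 is unitary and, for C_k = B_0^* B_k, Fourier inversion gives
   C_k + w C_{n-k}^* = sum_j z_j^k x_j x_j^*, which is the k-th power of C_1 + w C_{n-1}^*.
   Comparing constant coefficients in w yields C_k = C_1^k, from which both inclusions are immediate. *)

theory Submission
  imports Defs
begin

section \<open>Complex inner product, adjoints and semidefinite forms\<close>

definition cip :: "complex ^'n \<Rightarrow> complex ^'n \<Rightarrow> complex" where
  "cip x y = (\<Sum>i\<in>UNIV. cnj (x $ i) * y $ i)"

definition dagger :: "complex ^'n ^'m \<Rightarrow> complex ^'m ^'n" where
  "dagger A = (\<chi> i j. cnj (A $ j $ i))"

lemma dagger_nth [simp]: "dagger A $ i $ j = cnj (A $ j $ i)"
  by (simp add: dagger_def)

lemma dagger_dagger [simp]: "dagger (dagger A) = A"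
  by (simp add: vec_eq_iff)

lemma dagger_add: "dagger (A + B) = dagger A + dagger B"
  by (simp add: vec_eq_iff)

lemma dagger_mult: "dagger (A ** B) = dagger B ** dagger A"
  by (simp add: vec_eq_iff matrix_matrix_mult_def mult.commute)

lemma mat_mult_nth [simp]: "(mat c ** A) $ i $ j = c * A $ i $ j"
  by (simp add: matrix_matrix_mult_def mat_def if_distrib[of "\<lambda>x. x * _"] sum.delta cong: if_cong)

lemma mat_mult_vec: "(mat c ** A) *v x = c *s (A *v x)"
  by (simp add: vec_eq_iff matrix_vector_mult_def sum_distrib_left mult.assoc)

lemma mult_mat_right_nth: "(A ** (mat c ** B)) $ i $ j = c * (A ** B) $ i $ j"
  for A :: "complex ^'n ^'m"
  by (simp add: matrix_matrix_mult_def[of A] sum_distrib_left mult_ac)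

lemma mult_mat_left_nth: "((mat c ** A) ** B) $ i $ j = c * (A ** B) $ i $ j"
  for A :: "complex ^'n ^'m"
  by (simp flip: matrix_mul_assoc)

lemma Re_cip: "Re (cip x y) = x \<bullet> y"
  by (simp add: cip_def inner_vec_def inner_complex_def)

lemma cip_self: "cip x x = of_real ((norm x)\<^sup>2)"
  by (simp add: complex_eq_iff Re_cip power2_norm_eq_inner) (simp add: cip_def)

lemma cip_commute: "cip y x = cnj (cip x y)"
  by (simp add: cip_def mult.commute)

lemma cip_add_left: "cip (x + y) z = cip x z + cip y z"
  by (simp add: cip_def algebra_simps sum.distrib)

lemma cip_add_right: "cip x (y + z) = cip x y + cip x z"
  by (simp add: cip_def algebra_simps sum.distrib)

lemma cip_diff_right: "cip x (y - z) = cip x y - cip x z"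
  by (simp add: cip_def algebra_simps sum_subtractf)

lemma cip_scale_left: "cip (c *s x) y = cnj c * cip x y"
  by (simp add: cip_def sum_distrib_left mult_ac)

lemma cip_scale_right: "cip x (c *s y) = c * cip x y"
  by (simp add: cip_def sum_distrib_left mult_ac)

lemma cip_sum_right: "cip x (\<Sum>i\<in>I. f i) = (\<Sum>i\<in>I. cip x (f i))"
proof (induction I rule: infinite_finite_induct)
  case (insert i I)
  then show ?case by (simp add: cip_add_right)
qed (simp_all add: cip_def)

lemma cip_sum_left: "cip (\<Sum>i\<in>I. f i) y = (\<Sum>i\<in>I. cip (f i) y)"
proof (induction I rule: infinite_finite_induct)
  case (insert i I)
  then show ?case by (simp add: cip_add_left)
qed (simp_all add: cip_def)

lemma sum_mult_vec: "(\<Sum>i\<in>I. A i) *v x = (\<Sum>i\<in>I. A i *v x)"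
  by (induction I rule: infinite_finite_induct) (simp_all add: matrix_vector_mult_add_rdistrib)

lemma cip_dagger: "cip x (A *v y) = cip (dagger A *v x) y"
proof -
  have "cip x (A *v y) = (\<Sum>i\<in>UNIV. \<Sum>j\<in>UNIV. cnj (x $ i) * (A $ i $ j * y $ j))"
    by (simp add: cip_def matrix_vector_mult_def sum_distrib_left)
  also have "\<dots> = (\<Sum>j\<in>UNIV. \<Sum>i\<in>UNIV. cnj (x $ i) * (A $ i $ j * y $ j))"
    by (rule sum.swap)
  also have "\<dots> = cip (dagger A *v x) y"
    by (simp add: cip_def matrix_vector_mult_def sum_distrib_left mult_ac)
  finally show ?thesis .
qed

lemma dagger_congruence_nth:
  "(dagger X ** (A ** X)) $ j $ k = cip (column j X) (A *v column k X)"
  by (simp add: cip_def matrix_matrix_mult_def matrix_vector_mult_def column_def)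

text \<open>With \<open>w = cip x (H *v y)\<close>, a nonzero linear term
  \<open>2 * Re (c * w)\<close> would outweigh the quadratic term for small \<open>c\<close> and
  make the form negative. Positivity is asked only along \<open>x + c *s y\<close>, so the lemma
  also applies to forms that are positive on a subspace only.\<close>

lemma psd_cross_zero:
  assumes psd: "\<And>c. 0 \<le> Re (cip (x + c *s y) (H *v (x + c *s y)))"
    and herm: "dagger H = H"
    and zero: "Re (cip x (H *v x)) = 0"
  shows "cip x (H *v y) = 0"
proof -
  define w where "w = cip x (H *v y)"
  define s where "s = Re (cip y (H *v y))"
  \<comment> \<open>This step size gives \<open>r * s < 1\<close>, so the test scalar
    \<open>- of_real r * cnj w\<close> yields the value
    \<open>r * (norm w)\<^sup>2 * (r * s - 2)\<close>, which is negative unless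
    \<open>w = 0\<close>.\<close>
  define r where "r = 1 / (\<bar>s\<bar> + 1)"
  have yx: "cip y (H *v x) = cnj w"
    by (metis cip_commute cip_dagger herm w_def)
  have expand: "Re (cip (x + c *s y) (H *v (x + c *s y)))
      = 2 * Re (c * w) + (norm c)\<^sup>2 * s" for c
  proof -
    have "cip (x + c *s y) (H *v (x + c *s y))
        = cip x (H *v x) + c * w + cnj (c * w) + (cnj c * c) * cip y (H *v y)"
      by (simp add: matrix_vector_right_distrib vector_scalar_commute
          cip_add_left cip_add_right cip_scale_left cip_scale_right yx flip: w_def)
         (simp add: algebra_simps)
    also have "cnj c * c = of_real ((norm c)\<^sup>2)"
      by (metis complex_norm_square mult.commute of_real_power)
    finally show ?thesis
      using zero by (simp add: s_def)
  qed
  have r: "r > 0" "r * s < 1"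
    unfolding r_def by (auto simp: field_simps)
  have "0 \<le> 2 * Re ((- of_real r * cnj w) * w) + (norm (- of_real r * cnj w))\<^sup>2 * s"
    using psd[of "- of_real r * cnj w"] unfolding expand .
  also have "(- of_real r * cnj w) * w = of_real (- r * (norm w)\<^sup>2)"
    by (metis (no_types, lifting) complex_norm_square mult.assoc mult.commute of_real_minus of_real_mult)
  also have "(norm (- of_real r * cnj w))\<^sup>2 = r\<^sup>2 * (norm w)\<^sup>2"
    by (simp add: norm_mult power_mult_distrib)
  finally have "0 \<le> (r * (norm w)\<^sup>2) * (r * s - 2)"
    by (simp add: power2_eq_square algebra_simps)
  then have "(norm w)\<^sup>2 \<le> 0"
    using r by (smt (verit, best) mult_pos_neg zero_less_mult_iff)
  then show ?thesis
    by (simp add: w_def)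
qed

section \<open>Operator norm and its first-order variation\<close>

lemma norm_mult_vec_le: "norm (A *v x) \<le> op_norm A * norm x"
  for A :: "complex ^'n ^'m"
  unfolding op_norm_def by (rule onorm) (rule matrix_vector_mul_bounded_linear)

text \<open>The unit sphere is compact and nonempty, so a maximizer of the continuous function
  \<open>norm (A *v x)\<close> exists; homogeneity extends its bound to all vectors.\<close>

lemma op_norm_attained:
  fixes A :: "complex ^'n ^'m"
  obtains x where "norm x = 1" "norm (A *v x) = op_norm A"
proof -
  have "compact (sphere (0 :: complex ^'n) 1)"
    by simp
  moreover have "axis undefined 1 \<in> sphere (0 :: complex ^'n) 1"
    by (simp add: norm_axis_1)
  then have "sphere (0 :: complex ^'n) 1 \<noteq> {}"
    by blast
  moreover have "continuous_on (sphere 0 1) (\<lambda>x. norm (A *v x))"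
    by (intro continuous_on_norm linear_continuous_on matrix_vector_mul_bounded_linear)
  ultimately obtain x where x: "norm x = 1"
    and max: "\<And>y. norm y = 1 \<Longrightarrow> norm (A *v y) \<le> norm (A *v x)"
    using continuous_attains_sup[of "sphere 0 1" "\<lambda>x. norm (A *v x)"] by (metis mem_sphere_0)
  have "norm (A *v y) \<le> norm (A *v x) * norm y" for y
  proof (cases "y = 0")
    case False
    have "norm (A *v ((1 / norm y) *\<^sub>R y)) \<le> norm (A *v x)"
      by (rule max) (use False in simp)
    also have "A *v ((1 / norm y) *\<^sub>R y) = (1 / norm y) *\<^sub>R (A *v y)"
      by (rule linear_scale) simp
    finally show ?thesis
      using False by (simp add: field_simps)
  qed simp
  then have "op_norm A \<le> norm (A *v x)"
    unfolding op_norm_def by (intro onorm_le)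
  moreover have "norm (A *v x) \<le> op_norm A"
    using norm_mult_vec_le[of A x] x by simp
  ultimately show ?thesis
    using that x by fastforce
qed

lemma op_norm_mat_1: "op_norm (mat 1 :: complex ^'n ^'n) = 1"
  by (metis matrix_vector_mul_lid op_norm_attained)

lemma mat_of_real_mult_vec: "(mat (of_real t) ** A) *v x = t *\<^sub>R (A *v x)"
  for A :: "complex ^'n ^'m"
  by (simp add: mat_mult_vec vec_eq_iff scaleR_conv_of_real[where 'a = complex])

lemma norm_add_scaleR_square:
  "(norm (a + t *\<^sub>R b))\<^sup>2 = (norm a)\<^sup>2 + 2 * t * (a \<bullet> b) + t\<^sup>2 * (norm b)\<^sup>2"
  for a b :: "'a::real_inner"
  unfolding power2_norm_eq_inner by (simp add: algebra_simps power2_eq_square inner_commute)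

text \<open>For accretive \<open>G\<close>, the squared norm of \<open>1 - t G\<close> exceeds 1
  only to second order in \<open>t > 0\<close>. If the pairing were negative at a vector whose norm
  \<open>B\<close> preserves, \<open>B - t Y\<close> would grow to first order there.\<close>

lemma norm_attaining_pairing_nonneg:
  fixes B Y :: "complex ^'n ^'m" and G :: "complex ^'n ^'n"
  assumes isom: "\<And>t. op_norm (B + mat (of_real t) ** Y) \<le> op_norm (mat 1 + mat (of_real t) ** G)"
    and accretive: "\<And>u. 0 \<le> u \<bullet> (G *v u)"
    and x: "norm (B *v x) = norm x"
  shows "0 \<le> (B *v x) \<bullet> (Y *v x)"
proof (rule ccontr)
  define d where "d = - ((B *v x) \<bullet> (Y *v x))"
  define K where "K = op_norm G * norm x"
  assume "\<not> ?thesis"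
  then have d: "d > 0"
    by (simp add: d_def)
  \<comment> \<open>The choice makes \<open>t * K\<^sup>2 \<le> d\<close>, against the bound
    \<open>2 * d \<le> t * K\<^sup>2\<close> that the comparison yields.\<close>
  define t where "t = d / (K\<^sup>2 + 1)"
  have t: "t > 0"
    using d by (simp add: t_def add_nonneg_pos)
  obtain u\<^sub>0 where u\<^sub>0: "norm u\<^sub>0 = 1"
    "norm ((mat 1 + mat (of_real (- t)) ** G) *v u\<^sub>0) = op_norm (mat 1 + mat (of_real (- t)) ** G)"
    using op_norm_attained by blast
  define u where "u = norm x *\<^sub>R u\<^sub>0"
  have u: "norm u = norm x"
    "norm ((mat 1 + mat (of_real (- t)) ** G) *v u) = op_norm (mat 1 + mat (of_real (- t)) ** G) * norm x"
    using u\<^sub>0 by (simp_all add: u_def linear_scale[OF matrix_vector_mul_linear])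
  have vec: "(A + mat (of_real s) ** D) *v y = A *v y + s *\<^sub>R (D *v y)"
    for A D :: "complex ^'k ^'l" and s y
    by (simp only: matrix_vector_mult_add_rdistrib mat_of_real_mult_vec)
  have "(norm (B *v x + (- t) *\<^sub>R (Y *v x)))\<^sup>2 \<le> (norm (u + (- t) *\<^sub>R (G *v u)))\<^sup>2"
    using norm_mult_vec_le[of "B + mat (of_real (- t)) ** Y" x] u
      mult_right_mono[OF isom[of "- t"] norm_ge_zero[of x]]
    unfolding vec matrix_vector_mul_lid by (intro power_mono) (linarith, simp)
  then have "2 * t * d + t\<^sup>2 * (norm (Y *v x))\<^sup>2 \<le> - 2 * t * (u \<bullet> (G *v u)) + t\<^sup>2 * (norm (G *v u))\<^sup>2"
    unfolding norm_add_scaleR_square using x u by (simp add: d_def)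
  moreover have "t\<^sup>2 * (norm (G *v u))\<^sup>2 \<le> t\<^sup>2 * K\<^sup>2"
    using norm_mult_vec_le[of G u] u by (intro mult_left_mono power_mono) (auto simp: K_def)
  moreover have "0 \<le> 2 * t * (u \<bullet> (G *v u))" "0 \<le> t\<^sup>2 * (norm (Y *v x))\<^sup>2"
    using t accretive[of u] by auto
  ultimately have "t * (2 * d) \<le> t * (t * K\<^sup>2)"
    by (simp add: power2_eq_square algebra_simps)
  then have "2 * d \<le> t * K\<^sup>2"
    using t by simp
  also have "\<dots> \<le> d"
    using d add_nonneg_pos[of "K\<^sup>2" 1] by (simp add: t_def field_simps)
  finally show False
    using d by simp
qed

text \<open>Maximizers \<open>x m\<close> for \<open>B + t m Y\<close> with \<open>t m\<close>
  decreasing to 0 accumulate at a unit vector. Comparing squared norms to order zero shows that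
  \<open>B\<close> preserves its norm, and to order one that the pairing is at least
  \<open>c\<close>.\<close>

lemma norm_attaining_pairing_ge:
  fixes B Y :: "complex ^'n ^'m" and G :: "complex ^'n ^'n"
  assumes isom: "\<And>t. op_norm (mat 1 + mat (of_real t) ** G) \<le> op_norm (B + mat (of_real t) ** Y)"
    and B: "op_norm B \<le> 1"
    and u: "norm u = 1" "c \<le> u \<bullet> (G *v u)"
    and c: "0 \<le> c"
  obtains x where "norm x = 1" "norm (B *v x) = 1" "c \<le> (B *v x) \<bullet> (Y *v x)"
proof -
  define K where "K = op_norm Y"
  define t where "t m = 1 / real (Suc m)" for m
  have t: "t m > 0" for m
    by (simp add: t_def)
  have t_lim: "t \<longlonglongrightarrow> 0"
    unfolding t_def using LIMSEQ_inverse_real_of_nat by (simp add: divide_inverse)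
  have vec: "(A + mat (of_real s) ** D) *v y = A *v y + s *\<^sub>R (D *v y)"
    for A D :: "complex ^'k ^'l" and s y
    by (simp only: matrix_vector_mult_add_rdistrib mat_of_real_mult_vec)
  have "\<exists>x. norm x = 1 \<and> norm (u + t m *\<^sub>R (G *v u)) \<le> norm (B *v x + t m *\<^sub>R (Y *v x))" for m
  proof -
    obtain x where x: "norm x = 1"
      "norm ((B + mat (of_real (t m)) ** Y) *v x) = op_norm (B + mat (of_real (t m)) ** Y)"
      using op_norm_attained by blast
    moreover have "norm ((mat 1 + mat (of_real (t m)) ** G) *v u) \<le> op_norm (mat 1 + mat (of_real (t m)) ** G)"
      using norm_mult_vec_le[of "mat 1 + mat (of_real (t m)) ** G" u] u by simp
    ultimately show ?thesis
      using isom[of "t m"] unfolding vec matrix_vector_mul_lid by fastforce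
  qed
  then obtain x where x: "\<And>m. norm (x m) = 1"
    and ge: "\<And>m. norm (u + t m *\<^sub>R (G *v u)) \<le> norm (B *v x m + t m *\<^sub>R (Y *v x m))"
    by metis
  have Yx: "norm (Y *v x m) \<le> K" and Bx: "norm (B *v x m) \<le> 1" for m
    using norm_mult_vec_le[of Y "x m"] norm_mult_vec_le[of B "x m"] x[of m] B by (auto simp: K_def)
  have sq: "1 + 2 * t m * c \<le> (norm (B *v x m))\<^sup>2 + 2 * t m * ((B *v x m) \<bullet> (Y *v x m)) + (t m)\<^sup>2 * K\<^sup>2" for m
  proof -
    have "1 + 2 * t m * c \<le> 1 + 2 * t m * (u \<bullet> (G *v u)) + (t m)\<^sup>2 * (norm (G *v u))\<^sup>2"
      using u t[of m] by (simp add: add_increasing2)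
    also have "\<dots> = (norm (u + t m *\<^sub>R (G *v u)))\<^sup>2"
      unfolding norm_add_scaleR_square using u by simp
    also have "\<dots> \<le> (norm (B *v x m + t m *\<^sub>R (Y *v x m)))\<^sup>2"
      using ge[of m] by (simp add: power_mono)
    also have "\<dots> \<le> (norm (B *v x m))\<^sup>2 + 2 * t m * ((B *v x m) \<bullet> (Y *v x m)) + (t m)\<^sup>2 * K\<^sup>2"
      unfolding norm_add_scaleR_square using Yx[of m] by (simp add: power_mono mult_left_mono)
    finally show ?thesis .
  qed
  \<comment> \<open>First order: the terms of order zero cancel because
    \<open>norm (B *v x m) \<le> 1\<close>, and what remains is divided by
    \<open>t m\<close>.\<close>
  have pair: "c - t m * K\<^sup>2 \<le> (B *v x m) \<bullet> (Y *v x m)" for m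
  proof -
    have "(norm (B *v x m))\<^sup>2 \<le> 1"
      using Bx[of m] by (simp add: power_le_one)
    then have "t m * (2 * c) \<le> t m * (2 * ((B *v x m) \<bullet> (Y *v x m)) + t m * K\<^sup>2)"
      using sq[of m] by (simp add: power2_eq_square algebra_simps)
    then have "2 * c \<le> 2 * ((B *v x m) \<bullet> (Y *v x m)) + t m * K\<^sup>2"
      using t[of m] by simp
    moreover have "0 \<le> t m * K\<^sup>2"
      using t[of m] by simp
    ultimately show ?thesis
      by linarith
  qed
  \<comment> \<open>Order zero: Cauchy-Schwarz bounds the pairing by \<open>K\<close>, and
    \<open>0 \<le> c\<close> allows the left-hand term with \<open>c\<close> to be dropped.\<close>
  have norm_ge: "1 - 2 * t m * K - (t m)\<^sup>2 * K\<^sup>2 \<le> (norm (B *v x m))\<^sup>2" for m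
  proof -
    have "(B *v x m) \<bullet> (Y *v x m) \<le> norm (B *v x m) * norm (Y *v x m)"
      by (rule norm_cauchy_schwarz)
    also have "\<dots> \<le> 1 * K"
      using Bx[of m] Yx[of m] by (intro mult_mono) auto
    finally have "2 * t m * ((B *v x m) \<bullet> (Y *v x m)) \<le> 2 * t m * K"
      using t[of m] by simp
    moreover have "0 \<le> 2 * t m * c"
      using t[of m] c by simp
    ultimately show ?thesis
      using sq[of m] by linarith
  qed
  have "\<forall>m. x m \<in> sphere 0 1"
    using x by simp
  then obtain y r where y: "y \<in> sphere 0 1" and r: "strict_mono r" and lim: "(x \<circ> r) \<longlonglongrightarrow> y"
    using compact_sphere[of "0 :: complex ^'n" 1] unfolding compact_def by metis
  have tr: "(\<lambda>m. t (r m)) \<longlonglongrightarrow> 0"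
    using LIMSEQ_subseq_LIMSEQ[OF t_lim r] by (simp add: o_def)
  have mult_lim: "(\<lambda>m. A *v x (r m)) \<longlonglongrightarrow> A *v y" for A :: "complex ^'n ^'m"
    using bounded_linear.tendsto[OF matrix_vector_mul_bounded_linear[of A] lim] by (simp add: o_def)
  have "(\<lambda>m. c - t (r m) * K\<^sup>2) \<longlonglongrightarrow> c - 0 * K\<^sup>2"
    by (intro tendsto_intros tr)
  then have "c - 0 * K\<^sup>2 \<le> (B *v y) \<bullet> (Y *v y)"
    by (rule LIMSEQ_le[OF _ tendsto_inner[OF mult_lim mult_lim]]) (use pair in blast)
  moreover have "(\<lambda>m. 1 - 2 * t (r m) * K - (t (r m))\<^sup>2 * K\<^sup>2) \<longlonglongrightarrow> 1 - 2 * 0 * K - 0\<^sup>2 * K\<^sup>2"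
    by (intro tendsto_intros tr)
  then have "1 - 2 * 0 * K - 0\<^sup>2 * K\<^sup>2 \<le> (norm (B *v y))\<^sup>2"
    by (rule LIMSEQ_le[OF _ tendsto_power[OF tendsto_norm[OF mult_lim]]]) (use norm_ge in blast)
  then have "1 \<le> norm (B *v y)"
    using power2_le_imp_le[of 1 "norm (B *v y)"] by simp
  moreover have "norm (B *v y) \<le> 1"
    using norm_mult_vec_le[of B y] y B by simp
  ultimately show ?thesis
    using that y by simp
qed

section \<open>Index positions and powers of the shift\<close>

lemma idx_pos_less: "i < j \<Longrightarrow> idx_pos i < idx_pos j"
  unfolding idx_pos_def by (rule psubset_card_mono) auto

lemma inj_idx_pos: "inj idx_pos"
  by (rule linorder_injI) (metis idx_pos_less less_irrefl)

lemma bij_betw_idx_pos: "bij_betw idx_pos (UNIV :: 'n::{finite,wellorder} set) {..<CARD('n)}"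
proof -
  have "idx_pos i < CARD('n)" for i :: 'n
    unfolding idx_pos_def by (rule psubset_card_mono) auto
  then have "range (idx_pos :: 'n \<Rightarrow> nat) = {..<CARD('n)}"
    by (intro card_subset_eq) (auto simp: card_image inj_idx_pos)
  then show ?thesis
    by (simp add: bij_betw_def inj_idx_pos)
qed

lemma idx_pos_less_CARD: "idx_pos (i :: 'n) < CARD('n::{finite,wellorder})"
  using bij_betwE[OF bij_betw_idx_pos] by auto

lemma mat_pow_shift_mat_nth:
  "mat_pow shift_mat k $ i $ j = (if idx_pos j = idx_pos i + k then 1 else 0)"
  for i j :: "'n::{finite,wellorder}"
proof (induction k arbitrary: i)
  case 0
  then show ?case
    using inj_idx_pos by (auto simp: mat_def dest: injD)
next
  case (Suc k)
  have eq: "mat_pow shift_mat (Suc k) $ i $ j =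
      (\<Sum>m\<in>UNIV. if idx_pos m = Suc (idx_pos i) then mat_pow shift_mat k $ m $ j else 0)"
    by (auto simp: matrix_matrix_mult_def shift_mat_def intro!: sum.cong)
  show ?case
  proof (cases "\<exists>m :: 'n. idx_pos m = Suc (idx_pos i)")
    case True
    then obtain m :: 'n where m: "idx_pos m = Suc (idx_pos i)"
      by blast
    then have sel: "(idx_pos m' = Suc (idx_pos i)) = (m' = m)" for m' :: 'n
      using inj_idx_pos by (metis injD)
    show ?thesis
      unfolding eq sel by (simp add: Suc.IH m)
  next
    case False
    \<comment> \<open>Here \<open>i\<close> is the last index: its row in the shift is zero, and no
      column lies \<open>Suc k\<close> places further right.\<close>
    then have "\<not> Suc (idx_pos i) < CARD('n)"
      using bij_betw_imp_surj_on[OF bij_betw_idx_pos[where 'n = 'n]] by (metis imageE lessThan_iff)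
    then have "idx_pos j \<noteq> idx_pos i + Suc k"
      using idx_pos_less_CARD[of j] by linarith
    then show ?thesis
      using False by (simp add: eq del: mat_pow.simps)
  qed
qed

section \<open>Linear structure of the Toeplitz algebra\<close>

lemma mat_0_mult [simp]: "mat 0 ** A = 0" for A :: "complex ^'n ^'m"
  by (simp add: vec_eq_iff)

lemma mat_mult_add_left: "mat (a + b) ** A = mat a ** A + mat b ** A" for A :: "complex ^'n ^'m"
  by (simp add: vec_eq_iff algebra_simps)

text \<open>The degree may drop under addition or scaling; a freely chosen upper bound lets the sums
  be compared termwise.\<close>

lemma poly_mat_eq_sum:
  assumes "degree f \<le> N"
  shows "poly_mat f M = (\<Sum>i\<le>N. mat (coeff f i) ** mat_pow M i)"
  unfolding poly_mat_def
  by (rule sum.mono_neutral_left) (use assms in \<open>auto simp: coeff_eq_0\<close>)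

lemma toeplitz_alg_add:
  assumes "A \<in> toeplitz_alg" "B \<in> toeplitz_alg"
  shows "A + B \<in> toeplitz_alg"
proof -
  obtain f g where fg: "A = poly_mat f shift_mat" "B = poly_mat g shift_mat"
    using assms by (auto simp: toeplitz_alg_def)
  let ?N = "max (degree f) (degree g)"
  have "A + B = poly_mat (f + g) shift_mat"
    unfolding fg poly_mat_eq_sum[of f ?N, simplified] poly_mat_eq_sum[of g ?N, simplified]
      poly_mat_eq_sum[OF degree_add_le_max]
    by (simp add: sum.distrib mat_mult_add_left)
  then show ?thesis
    unfolding toeplitz_alg_def by blast
qed

lemma toeplitz_alg_mat_mult:
  assumes "A \<in> toeplitz_alg"
  shows "mat c ** A \<in> toeplitz_alg"
proof -
  obtain f where f: "A = poly_mat f shift_mat"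
    using assms by (auto simp: toeplitz_alg_def)
  have "mat c ** A = poly_mat (smult c f) shift_mat"
    unfolding poly_mat_eq_sum[OF degree_smult_le] f poly_mat_def
    by (simp add: vec_eq_iff sum_distrib_left mult_ac)
  then show ?thesis
    unfolding toeplitz_alg_def by blast
qed

lemma zero_in_toeplitz_alg: "0 \<in> toeplitz_alg"
proof -
  have "0 = poly_mat 0 shift_mat"
    by (simp add: poly_mat_def)
  then show ?thesis
    unfolding toeplitz_alg_def by blast
qed

lemma mat_pow_shift_mat_in_toeplitz_alg: "mat_pow shift_mat k \<in> toeplitz_alg"
proof -
  have "mat_pow shift_mat k = poly_mat (monom 1 k) shift_mat"
    by (simp add: poly_mat_eq_sum[OF degree_monom_le] if_distrib[of mat]
        if_distrib[of "\<lambda>x. x ** _"] cong: if_cong)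
  then show ?thesis
    unfolding toeplitz_alg_def by blast
qed

lemma sum_in_toeplitz_alg:
  "(\<And>i. i \<in> I \<Longrightarrow> A i \<in> toeplitz_alg) \<Longrightarrow> (\<Sum>i\<in>I. mat (c i) ** A i) \<in> toeplitz_alg"
  by (induction I rule: infinite_finite_induct)
     (auto simp: zero_in_toeplitz_alg intro!: toeplitz_alg_add toeplitz_alg_mat_mult)

section \<open>Herglotz matrices and their real parts\<close>

text \<open>The symbol is the truncated Taylor series of the Herglotz kernel
  $(1 + \bar z \zeta) / (1 - \bar z \zeta)$, whose real part is a positive point mass at $z$
  on the unit circle.\<close>

definition herglotz_coeff :: "complex \<Rightarrow> nat \<Rightarrow> complex" where
  "herglotz_coeff z k = (if k = 0 then 1 else 2 * cnj z ^ k)"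

definition herglotz_mat :: "complex \<Rightarrow> complex ^('n::{finite,wellorder}) ^('n::{finite,wellorder})" where
  "herglotz_mat z = (\<Sum>k<CARD('n). mat (herglotz_coeff z k) ** mat_pow shift_mat k)"

definition power_vec :: "complex \<Rightarrow> complex ^('n::{finite,wellorder})" where
  "power_vec z = (\<chi> p. z ^ idx_pos p)"

lemma herglotz_mat_in_toeplitz_alg: "herglotz_mat z \<in> toeplitz_alg"
  unfolding herglotz_mat_def by (intro sum_in_toeplitz_alg mat_pow_shift_mat_in_toeplitz_alg)

lemma herglotz_mat_nth:
  "herglotz_mat z $ p $ q =
    (if idx_pos p \<le> idx_pos q then herglotz_coeff z (idx_pos q - idx_pos p) else 0)"
  for p q :: "'n::{finite,wellorder}"
proof -
  have "herglotz_mat z $ p $ q =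
      (\<Sum>k<CARD('n). if k = idx_pos q - idx_pos p \<and> idx_pos p \<le> idx_pos q then herglotz_coeff z k else 0)"
    by (auto simp: herglotz_mat_def mat_pow_shift_mat_nth intro!: sum.cong)
  also have "idx_pos q - idx_pos p < CARD('n)"
    using idx_pos_less_CARD[of q] by linarith
  then have "(\<Sum>k<CARD('n). if k = idx_pos q - idx_pos p \<and> idx_pos p \<le> idx_pos q then herglotz_coeff z k else 0)
      = (if idx_pos p \<le> idx_pos q then herglotz_coeff z (idx_pos q - idx_pos p) else 0)"
    by (cases "idx_pos p \<le> idx_pos q") simp_all
  finally show ?thesis .
qed

lemma unit_power_diff:
  assumes "norm (z :: complex) = 1" "a \<le> b"
  shows "z ^ a * cnj z ^ b = cnj z ^ (b - a)" "cnj z ^ a * z ^ b = z ^ (b - a)"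
proof -
  have z: "z * cnj z = 1"
    using complex_norm_square[of z] assms by simp
  obtain c where "b = a + c"
    using assms le_Suc_ex by blast
  then show "z ^ a * cnj z ^ b = cnj z ^ (b - a)" "cnj z ^ a * z ^ b = z ^ (b - a)"
    using z by (auto simp: power_add mult.assoc[symmetric] power_mult_distrib[symmetric] mult.commute[of "cnj z" z])
qed

text \<open>As \<open>cnj z\<close> is the inverse of \<open>z\<close>, both triangles carry the
  same formula. The diagonal is met by both summands, which is why the constant coefficient of
  \<open>herglotz_coeff\<close> is 1 and not 2.\<close>

lemma herglotz_mat_real_part:
  assumes "norm z = 1"
  shows "(herglotz_mat z + dagger (herglotz_mat z)) $ p $ q = 2 * (z ^ idx_pos p * cnj z ^ idx_pos q)"
proof (cases "idx_pos p" "idx_pos q" rule: linorder_cases)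
  case less
  then show ?thesis
    using unit_power_diff(1)[OF assms, of "idx_pos p" "idx_pos q"]
    by (simp add: herglotz_mat_nth herglotz_coeff_def)
next
  case equal
  then show ?thesis
    using unit_power_diff(1)[OF assms, of "idx_pos p" "idx_pos q"]
    by (simp add: herglotz_mat_nth herglotz_coeff_def)
next
  case greater
  then show ?thesis
    using unit_power_diff(2)[OF assms, of "idx_pos q" "idx_pos p"]
    by (simp add: herglotz_mat_nth herglotz_coeff_def mult.commute)
qed

text \<open>The real inner product sees only the real part of the matrix, which is the rank one
  matrix of \<open>power_vec z\<close>. This gives accretivity at once.\<close>

lemma herglotz_mat_form:
  assumes "norm z = 1"
  shows "u \<bullet> (herglotz_mat z *v u) = (norm (cip (power_vec z) u))\<^sup>2"
proof -
  let ?G = "herglotz_mat z"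
  have "(?G + dagger ?G) *v u = (2 * cip (power_vec z) u) *s power_vec z"
    unfolding vec_eq_iff matrix_vector_mult_def herglotz_mat_real_part[OF assms]
    by (simp add: power_vec_def cip_def sum_distrib_left sum_distrib_right mult_ac)
  then have "cip u ((?G + dagger ?G) *v u) = 2 * cip (power_vec z) u * cnj (cip (power_vec z) u)"
    by (simp add: cip_scale_right cip_commute[of _ u])
  also have "\<dots> = of_real (2 * (norm (cip (power_vec z) u))\<^sup>2)"
    by (simp add: mult.assoc complex_norm_square del: of_real_power)
  finally have "Re (cip u ((?G + dagger ?G) *v u)) = 2 * (norm (cip (power_vec z) u))\<^sup>2"
    by (simp only: Re_complex_of_real)
  then have "Re (cip u (?G *v u)) + Re (cip u (dagger ?G *v u)) = 2 * (norm (cip (power_vec z) u))\<^sup>2"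
    by (simp add: matrix_vector_mult_add_rdistrib cip_add_right)
  moreover have "Re (cip u (dagger ?G *v u)) = Re (cip u (?G *v u))"
    unfolding cip_dagger[of u "dagger ?G"] dagger_dagger Re_cip by (rule inner_commute)
  ultimately show ?thesis
    by (simp add: Re_cip)
qed

lemma norm_power_vec:
  assumes "norm z = 1"
  shows "(norm (power_vec z :: complex ^('n::{finite,wellorder})))\<^sup>2 = CARD('n)"
proof -
  have "(norm (power_vec z :: complex ^('n::{finite,wellorder})))\<^sup>2 = (\<Sum>p\<in>UNIV. (norm (z ^ idx_pos (p::'n)))\<^sup>2)"
    by (simp add: norm_vec_def L2_set_def power_vec_def sum_nonneg)
  also have "\<dots> = CARD('n)"
    using assms by (simp add: norm_power)
  finally show ?thesis .
qed

text \<open>The rank one form takes its value at the normalized \<open>power_vec z\<close>, whose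
  squared length before scaling is \<open>CARD('n)\<close>.\<close>

lemma herglotz_mat_form_unit_vec:
  assumes "norm z = 1"
  obtains u :: "complex ^('n::{finite,wellorder})"
  where "norm u = 1" "u \<bullet> (herglotz_mat z *v u) = CARD('n)"
proof
  let ?v = "power_vec z :: complex ^('n::{finite,wellorder})"
  define r where "r = norm ?v"
  have r: "r\<^sup>2 = CARD('n)" "r > 0"
    using norm_power_vec[OF assms, where 'n = 'n] unfolding r_def
    by (auto simp: less_le)
  let ?u = "of_real (1 / r) *s ?v"
  show u: "norm ?u = 1"
  proof -
    have "?u = (1 / r) *\<^sub>R ?v"
      by (simp add: vec_eq_iff scaleR_conv_of_real[where 'a = complex])
    then show ?thesis
      using r by (simp add: r_def)
  qed
  have "cip ?v ?u = of_real r"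
    using r(2) unfolding cip_scale_right cip_self by (simp add: r_def power2_eq_square)
  then show "?u \<bullet> (herglotz_mat z *v ?u) = CARD('n)"
    using r(1) by (simp add: herglotz_mat_form[OF assms])
qed

section \<open>Roots of a unimodular number and discrete Fourier orthogonality\<close>

lemma sum_idx_pos: "(\<Sum>j\<in>(UNIV :: 'n::{finite,wellorder} set). f (idx_pos j)) = (\<Sum>k<CARD('n). f k)"
  by (rule sum.reindex_bij_betw[OF bij_betw_idx_pos])

text \<open>The roots are one fixed root times the powers of a primitive root of unity; mixed powers
  collapse to exponent \<open>l - k\<close> or \<open>k - l\<close>, and geometric sums vanish.
  Indexing by \<open>'n\<close> lets the roots label basis vectors later on.\<close>

lemma roots_orthogonality:
  assumes "norm \<omega> = 1"
  obtains z :: "'n::{finite,wellorder} \<Rightarrow> complex"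
  where "\<And>j. norm (z j) = 1" "\<And>j. z j ^ CARD('n) = \<omega>"
    "\<And>k l. k < CARD('n) \<Longrightarrow> l < CARD('n) \<Longrightarrow>
      (\<Sum>j\<in>UNIV. z j ^ l * cnj (z j) ^ k) = (if k = l then of_nat CARD('n) else 0)"
proof
  define n where "n = CARD('n)"
  have n: "n > 0"
    by (simp add: n_def)
  define w where "w = cis (Arg \<omega> / n)"
  define \<zeta> where "\<zeta> = cis (2 * pi / n)"
  let ?z = "\<lambda>j :: 'n. w * \<zeta> ^ idx_pos j"
  show unit: "norm (?z j) = 1" for j
    by (simp add: w_def \<zeta>_def norm_mult norm_power)
  have \<zeta>_pow: "\<zeta> ^ m = 1 \<longleftrightarrow> n dvd m" for m
  proof -
    have "\<zeta> ^ m = cis (real m * (2 * pi / n))"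
      by (simp add: \<zeta>_def Complex.DeMoivre)
    also have "\<dots> = exp (2 * of_real pi * \<i> * of_nat m / of_nat n)"
      by (simp add: cis_conv_exp mult_ac)
    finally show ?thesis
      using complex_root_unity_eq_1[of n m] n by simp
  qed
  have \<zeta>_pow_n: "(\<zeta> ^ p) ^ n = 1" for p
    unfolding power_mult[symmetric] by (simp add: \<zeta>_pow)
  have "\<omega> \<noteq> 0"
    using assms by auto
  then have "w ^ n = \<omega>"
    using assms n cis_Arg[of \<omega>] by (simp add: w_def Complex.DeMoivre sgn_div_norm)
  then show "?z j ^ CARD('n) = \<omega>" for j
    by (simp add: power_mult_distrib \<zeta>_pow_n flip: n_def)
  have vanish: "(\<Sum>j\<in>UNIV. ?z j ^ m) = 0" if m: "0 < m" "m < n" for m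
  proof -
    have "\<zeta> ^ m \<noteq> 1"
      using m by (auto simp: \<zeta>_pow dest: dvd_imp_le)
    then have "(\<Sum>k<n. (\<zeta> ^ m) ^ k) = 0"
      by (simp add: geometric_sum \<zeta>_pow_n)
    moreover have "(\<Sum>j\<in>UNIV. ?z j ^ m) = w ^ m * (\<Sum>k<n. (\<zeta> ^ m) ^ k)"
      unfolding n_def sum_idx_pos[symmetric]
      by (simp add: power_mult_distrib sum_distrib_left mult.commute flip: power_mult)
    ultimately show ?thesis
      by simp
  qed
  fix k l assume kl: "k < CARD('n)" "l < CARD('n)"
  show "(\<Sum>j\<in>UNIV. ?z j ^ l * cnj (?z j) ^ k) = (if k = l then of_nat CARD('n) else 0)"
  proof (cases k l rule: linorder_cases)
    case less
    have "(\<Sum>j\<in>UNIV. ?z j ^ l * cnj (?z j) ^ k) = (\<Sum>j\<in>UNIV. ?z j ^ (l - k))"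
      using unit_power_diff(2)[OF unit, of k l] less by (simp only: mult.commute less_imp_le)
    then show ?thesis
      using vanish[of "l - k"] less kl by (simp add: n_def)
  next
    case equal
    have "?z j ^ l * cnj (?z j) ^ l = 1" for j
      using unit_power_diff(1)[OF unit order_refl] by simp
    then show ?thesis
      using equal by simp
  next
    case greater
    have "(\<Sum>j\<in>UNIV. ?z j ^ l * cnj (?z j) ^ k) = (\<Sum>j\<in>UNIV. cnj (?z j) ^ (k - l))"
      using unit_power_diff(1)[OF unit, of l k] greater by (simp only: less_imp_le)
    also have "\<dots> = cnj (\<Sum>j\<in>UNIV. ?z j ^ (k - l))"
      by simp
    finally show ?thesis
      using vanish[of "k - l"] greater kl by (simp add: n_def)
  qed
qed

section \<open>Coefficients of quadratic matrix identities\<close>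

lemma matrix_add_rdistrib: "(A + B) ** C = A ** C + B ** C"
  by (simp add: vec_eq_iff matrix_matrix_mult_def sum.distrib distrib_right)

text \<open>Entrywise, both sides are polynomials of degree at most 2 in \<omega>. Their mean over
  the four points 1, -1, \<i>, -\<i> is the constant coefficient.\<close>

lemma quadratic_identity_const_coeff:
  fixes A B C D E F :: "complex ^'n ^'n"
  assumes "\<And>\<omega>. norm \<omega> = 1 \<Longrightarrow> A + mat \<omega> ** B = (C + mat \<omega> ** D) ** (E + mat \<omega> ** F)"
  shows "A = C ** E"
proof -
  have expand: "(C + mat \<omega> ** D) ** (E + mat \<omega> ** F)
      = C ** E + mat \<omega> ** (C ** F + D ** E) + mat (\<omega> * \<omega>) ** (D ** F)" for \<omega>
    by (simp add: vec_eq_iff matrix_add_ldistrib matrix_add_rdistrib mult_mat_right_nth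
        mult_mat_left_nth algebra_simps)
  have eq: "A $ p $ q + \<omega> * B $ p $ q
      = (C ** E) $ p $ q + \<omega> * (C ** F + D ** E) $ p $ q + \<omega> * \<omega> * (D ** F) $ p $ q"
    if "norm \<omega> = 1" for \<omega> p q
    using arg_cong[OF assms[OF that, unfolded expand], of "\<lambda>M. M $ p $ q"] by simp
  have "A $ p $ q = (C ** E) $ p $ q" for p q
    using eq[of 1 p q] eq[of "-1" p q] eq[of \<i> p q] eq[of "- \<i>" p q]
    by (simp add: algebra_simps) algebra
  then show ?thesis
    by (simp add: vec_eq_iff)
qed

section \<open>An orthonormal basis from extremal vectors\<close>

text \<open>On the norm-attaining subspace \<open>N\<close> of \<open>B\<close> the forms \<open>H j\<close> are positive and add up to
  \<open>2 n\<close> times the identity, while \<open>H j\<close> reaches \<open>2 n\<close> at some unit vector \<open>x j\<close>. All other forms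
  therefore vanish at \<open>x j\<close>, so that the \<open>x j\<close> are orthonormal; as there are \<open>n\<close> of them,
  \<open>N\<close> is everything.\<close>

lemma simultaneous_diagonalization:
  fixes B :: "complex ^'n ^'n" and Y :: "'n \<Rightarrow> complex ^'n ^'n"
  assumes contr: "op_norm B \<le> 1"
    and sumY: "(\<Sum>j\<in>UNIV. Y j) = mat (of_nat CARD('n)) ** B"
    and pos: "\<And>j x. norm (B *v x) = norm x \<Longrightarrow> 0 \<le> (B *v x) \<bullet> (Y j *v x)"
    and large: "\<And>j. \<exists>x. norm x = 1 \<and> norm (B *v x) = 1 \<and> CARD('n) \<le> (B *v x) \<bullet> (Y j *v x)"
  obtains X where "dagger X ** X = mat 1" "dagger B ** B = mat 1"
    "\<And>j. dagger X ** ((dagger B ** Y j + dagger (Y j) ** B) ** X)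
        = (\<chi> p q. if p = j \<and> q = j then 2 * of_nat CARD('n) else 0)"
proof -
  define n where "n = CARD('n)"
  define H where "H j = dagger B ** Y j + dagger (Y j) ** B" for j
  \<comment> \<open>As a fixed space, \<open>N\<close> is visibly closed under linear combinations;
    \<open>NI\<close> and \<open>ND\<close> identify it with the set of vectors whose norm
    \<open>B\<close> preserves.\<close>
  define N where "N = {x. (dagger B ** B) *v x = x}"
  have herm: "dagger (H j) = H j" for j
    by (simp add: H_def dagger_add dagger_mult add.commute)
  have H_form: "Re (cip x (H j *v x)) = 2 * ((B *v x) \<bullet> (Y j *v x))" for j x
    by (simp add: H_def matrix_vector_mult_add_rdistrib cip_add_right inner_commute
        cip_dagger[of x "dagger B" "Y j *v x"] cip_dagger[of x "dagger (Y j)" "B *v x"] Re_cip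
        flip: matrix_vector_mul_assoc)
  \<comment> \<open>The defect \<open>1 - dagger B ** B\<close> is positive because \<open>B\<close>
    is a contraction. Its form vanishes at \<open>x\<close>, hence so does the defect applied to
    \<open>x\<close>.\<close>
  have NI: "x \<in> N" if x: "norm (B *v x) = norm x" for x
  proof -
    define P where "P = mat 1 - dagger B ** B"
    have Pv: "P *v v = v - dagger B *v (B *v v)" for v
      by (simp add: P_def matrix_vector_mult_diff_rdistrib matrix_vector_mul_assoc)
    have P_form: "Re (cip v (P *v v)) = (norm v)\<^sup>2 - (norm (B *v v))\<^sup>2" for v
      by (simp add: Pv cip_diff_right cip_dagger[of v "dagger B"] Re_cip power2_norm_eq_inner)
    have "norm (B *v v) \<le> norm v" for v
      using norm_mult_vec_le[of B v] mult_right_mono[OF contr norm_ge_zero[of v]] by simp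
    then have psd: "0 \<le> Re (cip v (P *v v))" for v
      by (simp add: P_form power_mono)
    have dP: "dagger P = P"
      by (simp add: P_def vec_eq_iff mat_def matrix_matrix_mult_def mult.commute)
    have "cip x (P *v y) = 0" for y
      by (rule psd_cross_zero) (use psd dP x in \<open>auto simp: P_form\<close>)
    then have "cip (P *v x) (P *v x) = 0"
      by (metis cip_dagger dP)
    then have "P *v x = 0"
      by (simp add: cip_self)
    then show ?thesis
      by (simp add: N_def Pv matrix_vector_mul_assoc)
  qed
  have ND: "norm (B *v x) = norm x" if "x \<in> N" for x
  proof -
    have "(B *v x) \<bullet> (B *v x) = x \<bullet> x"
      using that cip_dagger[of x "dagger B" "B *v x"]
      by (simp add: N_def matrix_vector_mul_assoc flip: Re_cip)
    then show ?thesis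
      by (simp add: norm_eq_sqrt_inner)
  qed
  have psd: "0 \<le> Re (cip x (H j *v x))" if "x \<in> N" for x j
    using pos[OF ND[OF that]] by (simp add: H_form)
  have N_comb: "x + c *s y \<in> N" if "x \<in> N" "y \<in> N" for x y c
    using that by (simp add: N_def matrix_vector_right_distrib vector_scalar_commute)
  have sumH: "(\<Sum>j\<in>UNIV. cip x (H j *v y)) = 2 * of_nat n * cip x y" if "y \<in> N" for x y
  proof -
    have sumYv: "(\<Sum>j\<in>UNIV. Y j *v v) = of_nat n *s (B *v v)" for v
      by (simp add: sumY mat_mult_vec n_def flip: sum_mult_vec)
    have "cip x (H j *v y) = cip (B *v x) (Y j *v y) + cip (Y j *v x) (B *v y)" for j
      by (simp add: H_def matrix_vector_mult_add_rdistrib cip_add_right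
          cip_dagger[of x "dagger B"] cip_dagger[of x "dagger (Y j)"] flip: matrix_vector_mul_assoc)
    then have "(\<Sum>j\<in>UNIV. cip x (H j *v y)) = 2 * of_nat n * cip (B *v x) (B *v y)"
      by (simp add: sum.distrib sumYv cip_scale_left cip_scale_right
          flip: cip_sum_left cip_sum_right)
    also have "cip (B *v x) (B *v y) = cip x y"
      using that cip_dagger[of x "dagger B" "B *v y"] by (simp add: N_def matrix_vector_mul_assoc)
    finally show ?thesis .
  qed
  obtain x where x: "\<And>j. norm (x j) = 1" "\<And>j. norm (B *v x j) = 1"
    and big: "\<And>j. n \<le> (B *v x j) \<bullet> (Y j *v x j)"
    using large unfolding n_def by metis
  have xN: "x j \<in> N" for j
    using NI x by simp
  have total: "(\<Sum>i\<in>UNIV. Re (cip (x j) (H i *v x j))) = 2 * n" for j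
    using arg_cong[OF sumH[OF xN[of j], of "x j"], of Re] x(1)[of j] by (simp add: cip_self)
  have split: "(\<Sum>i\<in>UNIV. Re (cip (x j) (H i *v x j)))
      = Re (cip (x j) (H j *v x j)) + (\<Sum>i\<in>UNIV - {j}. Re (cip (x j) (H i *v x j)))" for j
    by (rule sum.remove) auto
  \<comment> \<open>All forms at \<open>x j\<close> add up to \<open>2 * n\<close>, and the
    \<open>j\<close>-th alone reaches this: \<open>big\<close> gives \<open>n\<close>, doubled by
    \<open>H_form\<close>. The others are nonnegative, so they vanish.\<close>
  have "(\<Sum>i\<in>UNIV - {j}. Re (cip (x j) (H i *v x j))) \<le> 0" for j
    using total[of j] split[of j] big[of j] by (simp add: H_form)
  then have off_sum: "(\<Sum>i\<in>UNIV - {j}. Re (cip (x j) (H i *v x j))) = 0" for j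
    by (meson antisym psd sum_nonneg xN)
  then have off: "Re (cip (x j) (H i *v x j)) = 0" if "i \<noteq> j" for i j
    using that psd[OF xN] sum_nonneg_eq_0_iff[of "UNIV - {j}" "\<lambda>i. Re (cip (x j) (H i *v x j))"] by auto
  have cross: "cip (x j) (H i *v x k) = 0" if "i \<noteq> j" for i j k
    by (rule psd_cross_zero) (use off[OF that] psd N_comb xN herm in auto)
  have cross': "cip (x j) (H i *v x k) = 0" if "i \<noteq> k" for i j k
    using cross[OF that, of j] by (metis cip_commute cip_dagger herm complex_cnj_zero)
  have orth: "cip (x j) (x k) = (if j = k then 1 else 0)" for j k
  proof (cases "j = k")
    case False
    \<comment> \<open>Every \<open>i\<close> differs from \<open>j\<close> or from \<open>k\<close>,
      so one of the two cross relations applies; summing over \<open>i\<close> then gives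
      orthogonality through \<open>sumH\<close>.\<close>
    have "cip (x j) (H i *v x k) = 0" for i
      using cross cross' False by metis
    then have "2 * of_nat n * cip (x j) (x k) = 0"
      using sumH[OF xN[of k], of "x j"] by simp
    then show ?thesis
      using False by (simp add: n_def)
  qed (simp add: cip_self x)
  have diag: "cip (x j) (H j *v x j) = 2 * of_nat n" for j
  proof -
    have "cip (x j) (H j *v x j) = (\<Sum>i\<in>UNIV. if i = j then cip (x j) (H j *v x j) else 0)"
      by simp
    also have "\<dots> = (\<Sum>i\<in>UNIV. cip (x j) (H i *v x j))"
      by (intro sum.cong) (auto simp: cross)
    finally show ?thesis
      using sumH[OF xN[of j], of "x j"] orth[of j j] by simp
  qed
  define X where "X = (\<chi> p j. x j $ p)"
  have col: "column j X = x j" for j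
    by (simp add: X_def column_def vec_eq_iff)
  have XX: "dagger X ** X = mat 1"
    using dagger_congruence_nth[of X "mat 1"] unfolding matrix_mul_lid matrix_vector_mul_lid col orth
    by (simp add: vec_eq_iff mat_def)
  moreover have "dagger B ** B = mat 1"
  proof -
    \<comment> \<open>The columns of \<open>X\<close> lie in \<open>N\<close>, so
      \<open>dagger B ** B\<close> fixes \<open>X\<close>, which is invertible.\<close>
    have "column j ((dagger B ** B) ** X) = column j X" for j
      using xN[of j] unfolding N_def col[symmetric]
      by (simp add: vec_eq_iff column_def matrix_matrix_mult_def matrix_vector_mult_def)
    then have "(dagger B ** B) ** X = X"
      by (simp add: vec_eq_iff column_def)
    then show ?thesis
      using XX by (metis matrix_left_right_inverse matrix_mul_assoc matrix_mul_rid)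
  qed
  moreover have "dagger X ** (H j ** X) = (\<chi> p q. if p = j \<and> q = j then 2 * of_nat CARD('n) else 0)" for j
    using cross[of j] cross'[of j] diag[of j]
    by (auto simp: vec_eq_iff dagger_congruence_nth col simp flip: n_def)
  ultimately show ?thesis
    using that unfolding H_def by blast
qed

text \<open>The second sum runs over powers of \<open>z\<close>. Since
  \<open>z ^ n = \<omega>\<close>, one has \<open>z ^ (n - k) = \<omega> * cnj z ^ k\<close>, so
  reversing its order turns everything into one Fourier sum in \<open>cnj z\<close>. The two
  constant terms merge by \<open>c 0 = d 0\<close>.\<close>

lemma herglotz_coeff_symmetrization:
  assumes z: "norm z = 1" "z ^ n = \<omega>" and n: "0 < n" and c: "c 0 = d 0"
  shows "(\<Sum>k<n. herglotz_coeff z k * c k) + (\<Sum>k<n. cnj (herglotz_coeff z k) * d k)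
    = (\<Sum>k<n. 2 * cnj z ^ k * (if k = 0 then c 0 else c k + \<omega> * d (n - k)))"
proof -
  obtain m where m: "n = Suc m"
    using n gr0_implies_Suc by blast
  have "(\<Sum>k<m. 2 * z ^ Suc k * d (Suc k)) = (\<Sum>k<m. 2 * z ^ Suc (m - Suc k) * d (Suc (m - Suc k)))"
    by (rule sum.nat_diff_reindex[symmetric])
  also have "\<dots> = (\<Sum>k<m. 2 * cnj z ^ Suc k * (\<omega> * d (n - Suc k)))"
  proof (rule sum.cong[OF refl])
    fix k assume k: "k \<in> {..<m}"
    then have "Suc (m - Suc k) = n - Suc k"
      using m by auto
    moreover have "z ^ (n - Suc k) = cnj z ^ Suc k * \<omega>"
      using unit_power_diff(2)[OF z(1), of "Suc k" n] k m z(2) by auto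
    ultimately show "2 * z ^ Suc (m - Suc k) * d (Suc (m - Suc k)) = 2 * cnj z ^ Suc k * (\<omega> * d (n - Suc k))"
      by simp
  qed
  finally have "(\<Sum>k<m. 2 * z ^ Suc k * d (Suc k)) = (\<Sum>k<m. 2 * cnj z ^ Suc k * (\<omega> * d (n - Suc k)))" .
  then show ?thesis
    using c unfolding m sum.lessThan_Suc_shift
    by (simp add: herglotz_coeff_def distrib_left sum.distrib del: power_Suc)
qed

section \<open>Powers in the image of the isometry and the two inclusions\<close>

theorem theorem4p2:
  fixes \<phi> :: "complex ^('n::{finite,wellorder}) ^('n::{finite,wellorder}) \<Rightarrow> complex ^('n::{finite,wellorder}) ^('n::{finite,wellorder})"
  assumes add: "\<And>A B. A \<in> toeplitz_alg \<Longrightarrow> B \<in> toeplitz_alg \<Longrightarrow> \<phi> (A + B) = \<phi> A + \<phi> B"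
      and smul: "\<And>c A. A \<in> toeplitz_alg \<Longrightarrow> \<phi> (mat c ** A) = mat c ** \<phi> A"
      and isom: "\<And>A. A \<in> toeplitz_alg \<Longrightarrow> op_norm (\<phi> A) = op_norm A"
  shows "\<forall>k \<in> {1..CARD('n) - 1}.
           {x. \<phi> shift_mat *v x = 0} \<subseteq> {x. \<phi> (mat_pow shift_mat k) *v x = 0}
         \<and> range (\<lambda>x. \<phi> (mat_pow shift_mat k) *v x) \<subseteq> range (\<lambda>x. \<phi> shift_mat *v x)"
proof -
  let ?S = "shift_mat :: complex ^('n::{finite,wellorder}) ^('n::{finite,wellorder})"
  define n where "n = CARD('n)"
  define B where "B k = \<phi> (mat_pow ?S k)" for k
  have n: "0 < n"
    by (simp add: n_def)
  have one: "mat 1 = mat_pow ?S 0"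
    by simp
  have S_eq: "?S = mat_pow ?S 1"
    by simp
  have phi_herglotz: "\<phi> (herglotz_mat z) = (\<Sum>k<n. mat (herglotz_coeff z k) ** B k)" for z
  proof -
    have "\<phi> (\<Sum>k<m. mat (c k) ** mat_pow ?S k) = (\<Sum>k<m. mat (c k) ** B k)" for m c
    proof (induction m)
      case 0
      show ?case
        using smul[OF zero_in_toeplitz_alg, of 0] by simp
    next
      case (Suc m)
      then show ?case
        by (simp add: B_def add smul sum_in_toeplitz_alg toeplitz_alg_mat_mult
            mat_pow_shift_mat_in_toeplitz_alg)
    qed
    then show ?thesis
      by (simp add: herglotz_mat_def n_def)
  qed
  have isom_line: "op_norm (B 0 + mat c ** \<phi> G) = op_norm (mat 1 + mat c ** G)"
    if "G \<in> toeplitz_alg" for c G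
    using isom[of "mat_pow ?S 0 + mat c ** G"] add[of "mat_pow ?S 0" "mat c ** G"] smul[OF that, of c] that
    unfolding B_def
    by (simp only: mat_pow_shift_mat_in_toeplitz_alg toeplitz_alg_mat_mult toeplitz_alg_add one)
  have contr: "op_norm (B 0) \<le> 1"
    using isom[OF mat_pow_shift_mat_in_toeplitz_alg[of 0]] by (simp add: B_def op_norm_mat_1)
  define C where "C k = dagger (B 0) ** B k" for k
  \<comment> \<open>These are the Fourier coefficients produced by
    \<open>herglotz_coeff_symmetrization\<close>; they depend on \<omega> but not on the chosen
    root. At \<open>k = 0\<close> the value anticipates \<open>C 0 = mat 1\<close>.\<close>
  define M where "M \<omega> k = (if k = 0 then mat 1 else C k + mat \<omega> ** dagger (C (n - k)))" for \<omega> k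
  have unit: "dagger (B 0) ** B 0 = mat 1"
    and power: "M \<omega> l = M \<omega> 1 ** M \<omega> (l - 1)"
    if \<omega>: "norm \<omega> = 1" and l: "0 < l" "l < n" for \<omega> l
  proof -
    obtain z :: "'n \<Rightarrow> complex" where z: "\<And>j. norm (z j) = 1" "\<And>j. z j ^ n = \<omega>"
      and orth: "\<And>k l. k < n \<Longrightarrow> l < n \<Longrightarrow>
        (\<Sum>j\<in>UNIV. z j ^ l * cnj (z j) ^ k) = (if k = l then of_nat n else 0)"
      using roots_orthogonality[OF \<omega>, where 'n = 'n] unfolding n_def by metis
    define Y where "Y j = \<phi> (herglotz_mat (z j))" for j
    \<comment> \<open>Orthogonality against exponent 0 leaves only the constant coefficient: the
      Herglotz matrices of all roots add up to \<open>n\<close> times the identity.\<close>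
    have coeff_sum: "(\<Sum>j\<in>UNIV. herglotz_coeff (z j) k) = (if k = 0 then of_nat n else 0)" if "k < n" for k
      using orth[of k 0] that n by (auto simp: herglotz_coeff_def n_def simp flip: sum_distrib_left)
    have "(\<Sum>j\<in>UNIV. Y j) $ p $ q = (mat (of_nat CARD('n)) ** B 0) $ p $ q" for p q
    proof -
      have "(\<Sum>j\<in>UNIV. Y j) $ p $ q = (\<Sum>j\<in>UNIV. \<Sum>k<n. herglotz_coeff (z j) k * B k $ p $ q)"
        by (simp add: Y_def phi_herglotz)
      also have "\<dots> = (\<Sum>k<n. (\<Sum>j\<in>UNIV. herglotz_coeff (z j) k) * B k $ p $ q)"
        by (subst sum.swap) (simp add: sum_distrib_right)
      also have "\<dots> = (\<Sum>k<n. if k = 0 then of_nat n * B 0 $ p $ q else 0)"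
        by (intro sum.cong) (auto simp: coeff_sum)
      finally show ?thesis
        using n by (simp add: n_def)
    qed
    then have sumY: "(\<Sum>j\<in>UNIV. Y j) = mat (of_nat CARD('n)) ** B 0"
      by (simp add: vec_eq_iff)
    have pos: "0 \<le> (B 0 *v x) \<bullet> (Y j *v x)" if "norm (B 0 *v x) = norm x" for j x
      by (rule norm_attaining_pairing_nonneg[OF _ _ that, where G = "herglotz_mat (z j)"])
         (simp_all add: Y_def isom_line herglotz_mat_in_toeplitz_alg herglotz_mat_form z)
    have large: "\<exists>x. norm x = 1 \<and> norm (B 0 *v x) = 1 \<and> CARD('n) \<le> (B 0 *v x) \<bullet> (Y j *v x)" for j
    proof -
      obtain u :: "complex ^('n::{finite,wellorder})" where
        u: "norm u = 1" "u \<bullet> (herglotz_mat (z j) *v u) = CARD('n)"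
        using herglotz_mat_form_unit_vec z(1) by blast
      obtain x where "norm x = 1" "norm (B 0 *v x) = 1" "CARD('n) \<le> (B 0 *v x) \<bullet> (Y j *v x)"
        by (rule norm_attaining_pairing_ge[OF _ contr u(1), where G = "herglotz_mat (z j)" and Y = "Y j"
              and c = "CARD('n)"])
           (simp_all add: Y_def isom_line herglotz_mat_in_toeplitz_alg u(2))
      then show ?thesis
        by blast
    qed
    obtain X where XX: "dagger X ** X = mat 1" and unit: "dagger (B 0) ** B 0 = mat 1"
      and diag: "\<And>j. dagger X ** ((dagger (B 0) ** Y j + dagger (Y j) ** B 0) ** X)
        = (\<chi> p q. if p = j \<and> q = j then 2 * of_nat CARD('n) else 0)"
      using simultaneous_diagonalization[OF contr sumY pos large] by blast
    show "dagger (B 0) ** B 0 = mat 1"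
      by (fact unit)
    have XX': "X ** dagger X = mat 1"
      using XX matrix_left_right_inverse by blast
    have fourier: "dagger (B 0) ** Y j + dagger (Y j) ** B 0 = (\<Sum>k<n. mat (2 * cnj (z j) ^ k) ** M \<omega> k)" for j
    proof -
      have BY: "(dagger (B 0) ** Y j) $ p $ q = (\<Sum>k<n. herglotz_coeff (z j) k * C k $ p $ q)" for p q
      proof -
        have "dagger (B 0) ** Y j = (\<Sum>k<n. dagger (B 0) ** (mat (herglotz_coeff (z j) k) ** B k))"
          unfolding Y_def phi_herglotz
          by (induction n) (simp_all add: matrix_add_ldistrib)
        then show ?thesis
          by (simp add: mult_mat_right_nth C_def)
      qed
      have YB: "dagger (Y j) ** B 0 = dagger (dagger (B 0) ** Y j)"
        by (simp add: dagger_mult)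
      have "(dagger (B 0) ** Y j + dagger (Y j) ** B 0) $ p $ q
          = (\<Sum>k<n. mat (2 * cnj (z j) ^ k) ** M \<omega> k) $ p $ q" for p q
      proof -
        have "(dagger (B 0) ** Y j + dagger (Y j) ** B 0) $ p $ q
            = (\<Sum>k<n. herglotz_coeff (z j) k * C k $ p $ q)
              + (\<Sum>k<n. cnj (herglotz_coeff (z j) k) * cnj (C k $ q $ p))"
          by (simp add: YB BY)
        also have "\<dots> = (\<Sum>k<n. 2 * cnj (z j) ^ k *
            (if k = 0 then C 0 $ p $ q else C k $ p $ q + \<omega> * cnj (C (n - k) $ q $ p)))"
          by (rule herglotz_coeff_symmetrization[OF z n]) (auto simp: C_def unit mat_def)
        also have "\<dots> = (\<Sum>k<n. mat (2 * cnj (z j) ^ k) ** M \<omega> k) $ p $ q"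
          by (auto simp: M_def C_def unit intro!: sum.cong)
        finally show ?thesis .
      qed
      then show ?thesis
        by (simp add: vec_eq_iff)
    qed
    \<comment> \<open>Change to the orthonormal basis formed by the columns of
      \<open>X\<close>.\<close>
    define T where "T A = dagger X ** (A ** X)" for A
    have T_H: "(\<Sum>k<n. 2 * cnj (z j) ^ k * T (M \<omega> k) $ p $ q) = (if p = j \<and> q = j then 2 * of_nat n else 0)"
      for j p q
    proof -
      have "(\<Sum>k<n. 2 * cnj (z j) ^ k * T (M \<omega> k) $ p $ q) = T (\<Sum>k<n. mat (2 * cnj (z j) ^ k) ** M \<omega> k) $ p $ q"
        by (simp add: T_def dagger_congruence_nth sum_mult_vec cip_sum_right mat_mult_vec cip_scale_right)
      also have "\<dots> = (if p = j \<and> q = j then 2 * of_nat n else 0)"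
        unfolding T_def fourier[symmetric] diag by (simp add: n_def)
      finally show ?thesis .
    qed
    \<comment> \<open>Fourier inversion: \<open>T_H\<close> for the root \<open>z j\<close> is
      multiplied by \<open>z j ^ m\<close> and summed over \<open>j\<close>, which isolates
      \<open>k = m\<close>. All \<open>M \<omega> m\<close> thus become diagonal, with entries the
      powers of the roots.\<close>
    have T_M: "T (M \<omega> m) $ p $ q = (if p = q then z p ^ m else 0)" if m: "m < n" for m p q
    proof -
      have "2 * of_nat n * T (M \<omega> m) $ p $ q
          = (\<Sum>k<n. 2 * (if k = m then of_nat n else 0) * T (M \<omega> k) $ p $ q)"
        using m by (simp add: if_distrib[of "\<lambda>x. x * _"] if_distrib[of "\<lambda>x. _ * x"] cong: if_cong)
      also have "\<dots> = (\<Sum>k<n. 2 * (\<Sum>j\<in>UNIV. z j ^ m * cnj (z j) ^ k) * T (M \<omega> k) $ p $ q)"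
        using m by (intro sum.cong) (auto simp: orth)
      also have "\<dots> = (\<Sum>k<n. \<Sum>j\<in>UNIV. z j ^ m * (2 * cnj (z j) ^ k * T (M \<omega> k) $ p $ q))"
        by (simp add: sum_distrib_left sum_distrib_right mult_ac)
      also have "\<dots> = (\<Sum>j\<in>UNIV. z j ^ m * (\<Sum>k<n. 2 * cnj (z j) ^ k * T (M \<omega> k) $ p $ q))"
        by (subst sum.swap) (simp add: sum_distrib_left)
      also have "\<dots> = (\<Sum>j\<in>UNIV. if j = p then (if p = q then 2 * of_nat n * z p ^ m else 0) else 0)"
        unfolding T_H by (intro sum.cong) auto
      also have "\<dots> = 2 * of_nat n * (if p = q then z p ^ m else 0)"
        by simp
      finally show ?thesis
        using n by simp
    qed
    have "T (M \<omega> 1) ** T (M \<omega> (l - 1)) = T (M \<omega> l)"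
    proof -
      have "(T (M \<omega> 1) ** T (M \<omega> (l - 1))) $ p $ q
          = (\<Sum>r\<in>UNIV. if r = p then (if p = q then z p * z p ^ (l - 1) else 0) else 0)" for p q
        unfolding matrix_matrix_mult_def vec_lambda_beta
        by (rule sum.cong) (use l in \<open>auto simp: T_M\<close>)
      moreover have "z p * z p ^ (l - 1) = z p ^ l" for p
        using l by (simp add: power_eq_if)
      ultimately show ?thesis
        using l by (simp add: vec_eq_iff T_M)
    qed
    then have "X ** (T (M \<omega> 1) ** T (M \<omega> (l - 1))) ** dagger X = X ** T (M \<omega> l) ** dagger X"
      by simp
    moreover have T_inv: "X ** T A ** dagger X = A" for A
      unfolding T_def by (metis XX' matrix_mul_assoc matrix_mul_lid matrix_mul_rid)
    moreover have "T A ** T D = T (A ** D)" for A D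
      unfolding T_def by (metis XX' matrix_mul_assoc matrix_mul_lid)
    ultimately show "M \<omega> l = M \<omega> 1 ** M \<omega> (l - 1)"
      by simp
  qed
  have C_step: "C l = C 1 ** C (l - 1)" if l: "0 < l" "l < n" for l
  \<comment> \<open>For \<open>l = 1\<close> the factor \<open>M \<omega> 0\<close> is the identity
    and lacks the form with an \<omega>-term; \<open>C 0 = mat 1\<close> settles this case
    directly.\<close>
  proof (cases "l = 1")
    case True
    then show ?thesis
      using unit[of 1 l] l by (simp add: C_def)
  next
    case False
    show ?thesis
    proof (rule quadratic_identity_const_coeff)
      fix \<omega> :: complex assume "norm \<omega> = 1"
      from power[OF this l] show "C l + mat \<omega> ** dagger (C (n - l))
          = (C 1 + mat \<omega> ** dagger (C (n - 1))) ** (C (l - 1) + mat \<omega> ** dagger (C (n - (l - 1))))"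
        using l False by (simp add: M_def)
    qed
  qed
  show ?thesis
  proof
    fix k assume "k \<in> {1..CARD('n) - 1}"
    then have k: "0 < k" "k < n"
      by (auto simp: n_def)
    have "dagger (B 0) ** B 0 = mat 1"
      using unit[of 1 k] k by simp
    then have "B 0 ** dagger (B 0) = mat 1"
      using matrix_left_right_inverse by blast
    then have B_eq: "B l = B 0 ** C l" for l
      unfolding C_def by (metis matrix_mul_assoc matrix_mul_lid)
    have kernel: "C l *v x = 0" if "B 1 *v x = 0" "0 < l" "l < n" for l x
      using that(2,3)
    proof (induction l)
      case (Suc l)
      show ?case
      proof (cases "l = 0")
        case True
        then show ?thesis
          using that(1) by (simp add: C_def flip: matrix_vector_mul_assoc)
      next
        case False
        then show ?thesis
          using Suc C_step[of "Suc l"] by (simp flip: matrix_vector_mul_assoc)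
      qed
    qed simp
    \<comment> \<open>The kernel inclusion uses \<open>C 1\<close> as the outer factor repeatedly;
      for the range, \<open>B 0 ** C 1\<close> is regrouped into \<open>B 1\<close>.\<close>
    have B_split: "B k = B 1 ** C (k - 1)"
      using B_eq[of k] B_eq[of 1] C_step[OF k] by (simp add: matrix_mul_assoc)
    have "B k *v x = 0" if "B 1 *v x = 0" for x
      using kernel[OF that k] B_eq[of k] by (simp flip: matrix_vector_mul_assoc)
    moreover have "B k *v x \<in> range (\<lambda>x. B 1 *v x)" for x
      using B_split by (auto simp flip: matrix_vector_mul_assoc)
    ultimately show "{x. \<phi> shift_mat *v x = 0} \<subseteq> {x. \<phi> (mat_pow shift_mat k) *v x = 0}
        \<and> range (\<lambda>x. \<phi> (mat_pow shift_mat k) *v x) \<subseteq> range (\<lambda>x. \<phi> shift_mat *v x)"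
      using S_eq unfolding B_def by (auto simp del: mat_pow.simps)
  qed
qed

end
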